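(* Let $\mathbf A=(A_1,A_2)$ be a pair of linearly independent matrices in $\mathcal M_2(\mathbb C)$ and let $\Omega_{\mathbf A}=\{(z_1,z_2)\in\mathbb C^2:\|z_1A_1+z_2A_2\|_{\rm op}<1\}$, the open unit ball of the norm $\|(z_1,z_2)\|_{\Omega_{\mathbf A}}=\|z_1A_1+z_2A_2\|_{\rm op}$ on $\mathbb C^2$. If $A_1$ and $A_2$ are not simultaneously diagonalizable, then there exist $n\in\mathbb N$ and a contractive linear map from $(\mathbb C^2,\|\cdot\|_{\Omega_{\mathbf A}})$ to $\mathcal M_n(\mathbb C)$ which is not completely contractive.
   Context: $\|\cdot\|_{\rm op}$ is the operator norm of matrices acting between Euclidean spaces, and $\mathcal M_n(\mathbb C)$ carries it. "Simultaneously diagonalizable" means: there are unitary $2\times2$ matrices $U,W$ such that $UA_1W$ and $UA_2W$ are both diagonal (replacing $(A_1,A_2)$ by $(UA_1W,UA_2W)$ does not change $\Omega_{\mathbf A}$). For a norm $\|\cdot\|$ on $\mathbb C^2$ and $k\ge1$, an element $\Theta=(\Theta_1,\Theta_2)\in\mathbb C^2\otimes\mathcal M_k(\mathbb C)$ is given the norm $\|\Theta\|_k=\sup\{\|\lambda_1\Theta_1+\lambda_2\Theta_2\|_{\rm op}:\ \|(\lambda_1,\lambda_2)\|^*\le1\}$, where $\|\cdot\|^*$ is the dual norm with respect to the pairing $\lambda_1z_1+\lambda_2z_2$. A linear map $L:(\mathbb C^2,\|\cdot\|)\to\mathcal M_n(\mathbb C)$, $L(z)=z_1V_1+z_2V_2$,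 is contractive if $\|L(z)\|_{\rm op}\le\|z\|$ for all $z$, and completely contractive if $\|\Theta_1\otimes V_1+\Theta_2\otimes V_2\|_{\rm op}\le\|\Theta\|_k$ for all $k\ge1$ and all $\Theta\in\mathbb C^2\otimes\mathcal M_k(\mathbb C)$. *)

theory Defs
  imports "HOL-Analysis.L2_Norm" "Jordan_Normal_Form.Schur_Decomposition"
begin

definition euclid_norm :: "complex vec \<Rightarrow> real" where
  "euclid_norm v = L2_set (\<lambda>i. cmod (v $ i)) {..<dim_vec v}"

definition op_norm :: "complex mat \<Rightarrow> real" where
  "op_norm A = (SUP v\<in>{v \<in> carrier_vec (dim_col A). euclid_norm v \<le> 1}. euclid_norm (A *\<^sub>v v))"

definition unitary_mat :: "nat \<Rightarrow> complex mat \<Rightarrow> bool" where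
  "unitary_mat n U \<longleftrightarrow> U \<in> carrier_mat n n \<and>
     mat_adjoint U * U = 1\<^sub>m n \<and> U * mat_adjoint U = 1\<^sub>m n"

text \<open>The unitaries \<open>U\<close> and \<open>W\<close> are independent of each other (no conjugation).\<close>

definition simultaneously_diagonalizable :: "complex mat \<Rightarrow> complex mat \<Rightarrow> bool" where
  "simultaneously_diagonalizable A1 A2 \<longleftrightarrow>
     (\<exists>U W. unitary_mat 2 U \<and> unitary_mat 2 W \<and>
        diagonal_mat (U * A1 * W) \<and> diagonal_mat (U * A2 * W))"

text \<open>Linear independence of the pair \<open>(A1, A2)\<close>; in particular it forces \<open>A1 \<noteq> A2\<close>.\<close>

definition lin_indep_pair :: "complex mat \<Rightarrow> complex mat \<Rightarrow> bool" where
  "lin_indep_pair A1 A2 \<longleftrightarrow>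
     (\<forall>a b. a \<cdot>\<^sub>m A1 + b \<cdot>\<^sub>m A2 = 0\<^sub>m (dim_row A1) (dim_col A1) \<longrightarrow> a = 0 \<and> b = 0)"

definition kronecker :: "complex mat \<Rightarrow> complex mat \<Rightarrow> complex mat" where
  "kronecker A B = mat (dim_row A * dim_row B) (dim_col A * dim_col B)
     (\<lambda>(i, j). A $$ (i div dim_row B, j div dim_col B) * B $$ (i mod dim_row B, j mod dim_col B))"

text \<open>
  Norms on \<open>\<complex>\<^sup>2\<close> are passed as functions \<open>N\<close> on \<open>complex \<times> complex\<close>; the library norm of
  the product type plays no role. The set \<open>\<Omega>\<^sub>A\<close> is \<open>{z. Omega_norm A1 A2 z < 1}\<close>.
\<close>

definition Omega_norm :: "complex mat \<Rightarrow> complex mat \<Rightarrow> complex \<times> complex \<Rightarrow> real" where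
  "Omega_norm A1 A2 z = op_norm (fst z \<cdot>\<^sub>m A1 + snd z \<cdot>\<^sub>m A2)"

definition dual_norm :: "(complex \<times> complex \<Rightarrow> real) \<Rightarrow> complex \<times> complex \<Rightarrow> real" where
  "dual_norm N l = (SUP z\<in>{z. N z \<le> 1}. cmod (fst l * fst z + snd l * snd z))"

text \<open>The norm on \<open>\<complex>\<^sup>2 \<otimes> M\<^sub>k\<close>, an element being given by its two \<open>k \<times> k\<close> components.\<close>

definition matrix_level_norm ::
    "(complex \<times> complex \<Rightarrow> real) \<Rightarrow> complex mat \<Rightarrow> complex mat \<Rightarrow> real" where
  "matrix_level_norm N T1 T2 =
     (SUP l\<in>{l. dual_norm N l \<le> 1}. op_norm (fst l \<cdot>\<^sub>m T1 + snd l \<cdot>\<^sub>m T2))"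

definition linear_to_mat :: "nat \<Rightarrow> (complex \<times> complex \<Rightarrow> complex mat) \<Rightarrow> bool" where
  "linear_to_mat n L \<longleftrightarrow>
     (\<forall>z. L z \<in> carrier_mat n n) \<and>
     (\<forall>z1 z2 w1 w2. L (z1 + w1, z2 + w2) = L (z1, z2) + L (w1, w2)) \<and>
     (\<forall>c z1 z2. L (c * z1, c * z2) = c \<cdot>\<^sub>m L (z1, z2))"

definition contractive ::
    "(complex \<times> complex \<Rightarrow> real) \<Rightarrow> (complex \<times> complex \<Rightarrow> complex mat) \<Rightarrow> bool" where
  "contractive N L \<longleftrightarrow> (\<forall>z. op_norm (L z) \<le> N z)"

text \<open>A linear \<open>L\<close> has the form \<open>L z = z\<^sub>1 V\<^sub>1 + z\<^sub>2 V\<^sub>2\<close> with \<open>V\<^sub>1 = L (1, 0)\<close> and \<open>V\<^sub>2 = L (0, 1)\<close>.\<close>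

definition completely_contractive ::
    "(complex \<times> complex \<Rightarrow> real) \<Rightarrow> (complex \<times> complex \<Rightarrow> complex mat) \<Rightarrow> bool" where
  "completely_contractive N L \<longleftrightarrow>
     (\<forall>k\<ge>1. \<forall>T1\<in>carrier_mat k k. \<forall>T2\<in>carrier_mat k k.
        op_norm (kronecker T1 (L (1, 0)) + kronecker T2 (L (0, 1))) \<le> matrix_level_norm N T1 T2)"

end

theory Submission
  imports Defs
begin

text \<open>
  The map \<open>L z = z\<^sub>1 A\<^sub>1 + z\<^sub>2 A\<^sub>2\<close> is isometric, and up to unitaries it is the required map.
  The quadratic form \<open>det (z\<^sub>1 A\<^sub>1 + z\<^sub>2 A\<^sub>2)\<close> has a nontrivial zero, so after multiplying by unitaries the span of
  \<open>A\<^sub>1\<close>, \<open>A\<^sub>2\<close> is spanned by \<open>E = E\<^bsub>11\<^esub>\<close> and a matrix \<open>D\<close> with \<open>D\<^bsub>11\<^esub> = 0\<close>, and \<open>D\<close> has a nonzero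
  off-diagonal entry because the pair is not simultaneously diagonalizable. Choose \<open>\<Theta>\<close> such that
  \<open>\<Theta>\<^sub>1 \<otimes> A\<^sub>1 + \<Theta>\<^sub>2 \<otimes> A\<^sub>2 = K E \<otimes> E + D \<otimes> D\<close>. By the definition of the dual norm, the norm of \<open>\<Theta>\<close> is
  at most the supremum of this form over pairs of product unit vectors. For large \<open>K\<close> that supremum
  is \<open>K\<close>, since moving the factors away from \<open>e\<^sub>1\<close> loses at least as much in \<open>K E \<otimes> E\<close> as it gains
  in \<open>D \<otimes> D\<close>. The operator norm exceeds \<open>K\<close>: the first row and the first column of the matrix have
  corner entry \<open>K\<close>, and one of them has another nonzero entry \<open>(D\<^bsub>12\<^esub>)\<^sup>2\<close> or \<open>(D\<^bsub>21\<^esub>)\<^sup>2\<close>.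
\<close>

section \<open>Euclidean norm and operator norm\<close>

lemma euclid_norm_ge_0 [simp]: "0 \<le> euclid_norm v"
  by (simp add: euclid_norm_def)

lemma euclid_norm_sq: "(euclid_norm v)\<^sup>2 = (\<Sum>i<dim_vec v. (cmod (v $ i))\<^sup>2)"
  by (simp add: euclid_norm_def L2_set_def sum_nonneg)

lemma euclid_norm_sq_eq_scalar_prod:
  "complex_of_real ((euclid_norm v)\<^sup>2) = conjugate v \<bullet> v"
  unfolding euclid_norm_sq scalar_prod_def of_real_sum lessThan_atLeast0
  by (rule sum.cong) (simp_all add: complex_norm_square mult.commute del: of_real_power)

lemma euclid_norm_smult: "euclid_norm (c \<cdot>\<^sub>v v) = cmod c * euclid_norm v"
proof -
  have "euclid_norm (c \<cdot>\<^sub>v v) = L2_set (\<lambda>i. cmod c * cmod (v $ i)) {..<dim_vec v}"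
    unfolding euclid_norm_def by (rule L2_set_cong) (simp_all add: norm_mult)
  then show ?thesis by (simp add: euclid_norm_def L2_set_right_distrib)
qed

lemma euclid_norm_unit_vec:
  assumes "i < n"
  shows "euclid_norm (unit_vec n i) = 1"
proof -
  have "(euclid_norm (unit_vec n i))\<^sup>2 = (\<Sum>k<n. if k = i then 1 else 0)"
    unfolding euclid_norm_sq using assms by (intro sum.cong) (auto simp: unit_vec_def)
  also have "\<dots> = 1" using assms by simp
  finally have "(euclid_norm (unit_vec n i))\<^sup>2 = 1\<^sup>2" by simp
  then show ?thesis by (rule power2_eq_imp_eq) simp_all
qed

lemma euclid_norm_zero [simp]: "euclid_norm (0\<^sub>v n) = 0"
  by (simp add: euclid_norm_def L2_set_def)

lemma cmod_vec_index_le: "i < dim_vec v \<Longrightarrow> cmod (v $ i) \<le> euclid_norm v"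
  unfolding euclid_norm_def by (rule member_le_L2_set) auto

lemma cmod_scalar_prod_le:
  assumes "dim_vec x = dim_vec y"
  shows "cmod (x \<bullet> y) \<le> euclid_norm x * euclid_norm y"
proof -
  have "cmod (x \<bullet> y) \<le> (\<Sum>i<dim_vec y. cmod (x $ i) * cmod (y $ i))"
    unfolding scalar_prod_def by (rule order.trans[OF norm_sum])
      (simp add: norm_mult lessThan_atLeast0)
  also have "\<dots> \<le> euclid_norm x * euclid_norm y"
    using L2_set_mult_ineq[of "\<lambda>i. cmod (x $ i)" "\<lambda>i. cmod (y $ i)" "{..<dim_vec y}"] assms
    by (simp add: euclid_norm_def)
  finally show ?thesis .
qed

lemma bdd_above_op_norm:
  "bdd_above ((\<lambda>v. euclid_norm (A *\<^sub>v v)) ` {v \<in> carrier_vec (dim_col A). euclid_norm v \<le> 1})"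
proof (rule bdd_aboveI2)
  fix v assume v: "v \<in> {v \<in> carrier_vec (dim_col A). euclid_norm v \<le> 1}"
  have "euclid_norm (A *\<^sub>v v) \<le> (\<Sum>i<dim_row A. cmod ((A *\<^sub>v v) $ i))"
    using L2_set_le_sum[of "{..<dim_row A}" "\<lambda>i. cmod ((A *\<^sub>v v) $ i)"]
    by (simp add: euclid_norm_def)
  also have "\<dots> \<le> (\<Sum>i<dim_row A. euclid_norm (row A i))"
  proof (rule sum_mono)
    fix i assume "i \<in> {..<dim_row A}"
    then have "cmod ((A *\<^sub>v v) $ i) \<le> euclid_norm (row A i) * euclid_norm v"
      using v by (auto intro!: cmod_scalar_prod_le)
    also have "\<dots> \<le> euclid_norm (row A i)"
      using v by (simp add: mult_left_le)
    finally show "cmod ((A *\<^sub>v v) $ i) \<le> euclid_norm (row A i)" .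
  qed
  finally show "euclid_norm (A *\<^sub>v v) \<le> (\<Sum>i<dim_row A. euclid_norm (row A i))" .
qed

lemma op_norm_upper:
  "v \<in> carrier_vec (dim_col A) \<Longrightarrow> euclid_norm v \<le> 1 \<Longrightarrow> euclid_norm (A *\<^sub>v v) \<le> op_norm A"
  unfolding op_norm_def by (rule cSUP_upper[OF _ bdd_above_op_norm]) simp

lemma op_norm_least:
  assumes "\<And>v. v \<in> carrier_vec (dim_col A) \<Longrightarrow> euclid_norm v \<le> 1 \<Longrightarrow> euclid_norm (A *\<^sub>v v) \<le> c"
  shows "op_norm A \<le> c"
  unfolding op_norm_def
proof (rule cSUP_least)
  have "0\<^sub>v (dim_col A) \<in> {v \<in> carrier_vec (dim_col A). euclid_norm v \<le> 1}" by simp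
  then show "{v \<in> carrier_vec (dim_col A). euclid_norm v \<le> 1} \<noteq> {}" by blast
qed (use assms in auto)

lemma op_norm_ge_0 [simp]: "0 \<le> op_norm A"
  using order.trans[OF euclid_norm_ge_0 op_norm_upper[of "0\<^sub>v (dim_col A)" A]] by simp

text \<open>If \<open>r\<close>, the norm of \<open>A v\<close>, is nonzero, the conjugate of
  \<open>A v\<close> divided by \<open>r\<close> is a unit vector \<open>y\<close> whose bilinear
  product with \<open>A v\<close> is \<open>r\<close>. Hence bounding the form
  \<open>y \<bullet> (A *\<^sub>v x)\<close>, without conjugation, suffices.\<close>

lemma op_norm_leI:
  assumes A: "A \<in> carrier_mat m n" and c: "0 \<le> c"
    and le: "\<And>x y. x \<in> carrier_vec n \<Longrightarrow> y \<in> carrier_vec m \<Longrightarrow> euclid_norm x \<le> 1 \<Longrightarrow>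
      euclid_norm y \<le> 1 \<Longrightarrow> cmod (y \<bullet> (A *\<^sub>v x)) \<le> c"
  shows "op_norm A \<le> c"
proof (rule op_norm_least)
  fix v assume v: "v \<in> carrier_vec (dim_col A)" "euclid_norm v \<le> 1"
  define r where "r = euclid_norm (A *\<^sub>v v)"
  show "euclid_norm (A *\<^sub>v v) \<le> c"
  proof (cases "r = 0")
    case False
    then have r: "r > 0" unfolding r_def using euclid_norm_ge_0[of "A *\<^sub>v v"] by linarith
    define w where "w = conjugate (A *\<^sub>v v)"
    have nw: "euclid_norm w = r"
      by (simp add: w_def r_def euclid_norm_def L2_set_def)
    define y where "y = complex_of_real (1 / r) \<cdot>\<^sub>v w"
    have y: "y \<in> carrier_vec m" unfolding y_def w_def using A by (intro carrier_vecI) auto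
    have "euclid_norm y = 1"
      unfolding y_def euclid_norm_smult nw using r by (simp add: norm_divide)
    then have "cmod (y \<bullet> (A *\<^sub>v v)) \<le> c"
      using v A y by (intro le) auto
    moreover have "y \<bullet> (A *\<^sub>v v) = complex_of_real (1 / r) * complex_of_real (r\<^sup>2)"
      unfolding r_def euclid_norm_sq_eq_scalar_prod y_def w_def
      using A v by (simp del: of_real_power)
    ultimately show ?thesis
      using r unfolding r_def[symmetric] by (simp add: norm_mult power2_eq_square)
  qed (use c r_def in simp)
qed

section \<open>Unitary invariance and entrywise lower bounds of the operator norm\<close>

lemma mat_adjoint_carrier: "A \<in> carrier_mat m n \<Longrightarrow> mat_adjoint A \<in> carrier_mat n m"
  unfolding mat_adjoint_def by (intro carrier_matI) simp_all

lemma index_mat_adjoint: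
  "A \<in> carrier_mat m n \<Longrightarrow> i < n \<Longrightarrow> j < m \<Longrightarrow> mat_adjoint A $$ (i, j) = cnj (A $$ (j, i))"
  by (simp add: mat_adjoint_def mat_of_rows_index)

lemma unitary_mat_adjoint:
  assumes "unitary_mat n U"
  shows "unitary_mat n (mat_adjoint U)"
proof -
  have U: "U \<in> carrier_mat n n" using assms by (simp add: unitary_mat_def)
  have "mat_adjoint (mat_adjoint U) = U"
  proof (rule eq_matI)
    fix i j assume "i < dim_row U" "j < dim_col U"
    then have "i < n" "j < n" using U by auto
    then show "mat_adjoint (mat_adjoint U) $$ (i, j) = U $$ (i, j)"
      by (simp add: index_mat_adjoint[OF mat_adjoint_carrier[OF U]] index_mat_adjoint[OF U])
  qed (use U mat_adjoint_carrier[OF mat_adjoint_carrier[OF U]] in auto)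
  then show ?thesis using assms U by (simp add: unitary_mat_def mat_adjoint_carrier)
qed

text \<open>The squared norm is a bilinear product of the conjugate vector with the vector; a
  transpose moves \<open>U\<close> across it and leaves
  \<open>mat_adjoint U * U = 1\<close>.\<close>

lemma euclid_norm_unitary:
  assumes "unitary_mat n U" and v: "v \<in> carrier_vec n"
  shows "euclid_norm (U *\<^sub>v v) = euclid_norm v"
proof -
  have U: "U \<in> carrier_mat n n" and inv: "mat_adjoint U * U = 1\<^sub>m n"
    using assms by (auto simp: unitary_mat_def)
  note B = mat_adjoint_carrier[OF U]
  have "conjugate (U *\<^sub>v v) = transpose_mat (mat_adjoint U) *\<^sub>v conjugate v"
  proof (rule eq_vecI)
    fix i assume "i < dim_vec (transpose_mat (mat_adjoint U) *\<^sub>v conjugate v)"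
    then have i: "i < n" using B by simp
    show "conjugate (U *\<^sub>v v) $ i = (transpose_mat (mat_adjoint U) *\<^sub>v conjugate v) $ i"
      using i U B v by (simp add: scalar_prod_def index_mat_adjoint[OF U])
  qed (use U B in auto)
  then have "conjugate (U *\<^sub>v v) \<bullet> (U *\<^sub>v v) = conjugate v \<bullet> (mat_adjoint U *\<^sub>v (U *\<^sub>v v))"
    using B U v by (simp add: transpose_vec_mult_scalar[where nr = n and nc = n])
  also have "mat_adjoint U *\<^sub>v (U *\<^sub>v v) = v"
    using B U v inv by (simp flip: assoc_mult_mat_vec)
  finally have "complex_of_real ((euclid_norm (U *\<^sub>v v))\<^sup>2) = complex_of_real ((euclid_norm v)\<^sup>2)"
    unfolding euclid_norm_sq_eq_scalar_prod .
  then show ?thesis by (simp del: of_real_power)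
qed

text \<open>Unitary factors cannot increase the norm. Undoing them with their adjoints, which are
  unitary too, gives the reverse inequality.\<close>

lemma op_norm_unitary:
  assumes U: "unitary_mat n U" and W: "unitary_mat n W" and X: "X \<in> carrier_mat n n"
  shows "op_norm (U * X * W) = op_norm X"
proof -
  have Uc: "U \<in> carrier_mat n n" and Wc: "W \<in> carrier_mat n n"
    using U W by (auto simp: unitary_mat_def)
  have le: "op_norm (P * Y * Q) \<le> op_norm Y"
    if P: "unitary_mat n P" and Q: "unitary_mat n Q" and Y: "Y \<in> carrier_mat n n" for P Q Y
  proof (rule op_norm_least)
    have Pc: "P \<in> carrier_mat n n" and Qc: "Q \<in> carrier_mat n n"
      using P Q by (auto simp: unitary_mat_def)
    fix v assume "v \<in> carrier_vec (dim_col (P * Y * Q))" and v1: "euclid_norm v \<le> 1"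
    then have v: "v \<in> carrier_vec n" using Qc by simp
    have "(P * Y * Q) *\<^sub>v v = P *\<^sub>v (Y *\<^sub>v (Q *\<^sub>v v))"
      using Pc Qc Y v by (simp add: assoc_mult_mat_vec[where n\<^sub>2 = n and n\<^sub>3 = n and n\<^sub>1 = n])
    then have "euclid_norm ((P * Y * Q) *\<^sub>v v) = euclid_norm (Y *\<^sub>v (Q *\<^sub>v v))"
      using P Y Qc v by (simp add: euclid_norm_unitary)
    also have "\<dots> \<le> op_norm Y"
      using Q Qc Y v v1 by (intro op_norm_upper) (auto simp: euclid_norm_unitary)
    finally show "euclid_norm ((P * Y * Q) *\<^sub>v v) \<le> op_norm Y" .
  qed
  have adj: "mat_adjoint U \<in> carrier_mat n n" "mat_adjoint W \<in> carrier_mat n n"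
    using Uc Wc by (simp_all add: mat_adjoint_carrier)
  have "mat_adjoint U * (U * X * W) * mat_adjoint W = (mat_adjoint U * U) * X * (W * mat_adjoint W)"
    using adj Uc Wc X by (simp add: assoc_mult_mat[where n\<^sub>1 = n and n\<^sub>2 = n and n\<^sub>3 = n and n\<^sub>4 = n])
  also have "\<dots> = X" using U W X by (simp add: unitary_mat_def)
  finally have eq: "mat_adjoint U * (U * X * W) * mat_adjoint W = X" .
  show ?thesis
    using le[OF U W X] le[OF unitary_mat_adjoint[OF U] unitary_mat_adjoint[OF W], of "U * X * W", unfolded eq]
      Uc Wc X by (intro antisym) auto
qed

lemma op_norm_smult_le: "op_norm (c \<cdot>\<^sub>m A) \<le> cmod c * op_norm A"
proof (rule op_norm_least)
  fix v assume v: "v \<in> carrier_vec (dim_col (c \<cdot>\<^sub>m A))" "euclid_norm v \<le> 1"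
  have "(c \<cdot>\<^sub>m A) *\<^sub>v v = c \<cdot>\<^sub>v (A *\<^sub>v v)"
    by (rule eq_vecI) (use v in auto)
  then show "euclid_norm ((c \<cdot>\<^sub>m A) *\<^sub>v v) \<le> cmod c * op_norm A"
    using v by (simp add: euclid_norm_smult mult_left_mono op_norm_upper)
qed

lemma euclid_norm_col_le_op_norm:
  assumes "j < dim_col A"
  shows "euclid_norm (col A j) \<le> op_norm A"
proof -
  have "A *\<^sub>v unit_vec (dim_col A) j = col A j"
    by (rule eq_vecI) (use assms in auto)
  then show ?thesis
    using op_norm_upper[of "unit_vec (dim_col A) j" A] assms by (simp add: euclid_norm_unit_vec)
qed

text \<open>The normalized conjugate of the row is a unit vector whose image has the norm of the row
  as its entry \<open>i\<close>.\<close>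

lemma euclid_norm_row_le_op_norm:
  assumes i: "i < dim_row A"
  shows "euclid_norm (row A i) \<le> op_norm A"
proof (cases "euclid_norm (row A i) = 0")
  case False
  define r where "r = euclid_norm (row A i)"
  have r: "r > 0" unfolding r_def using False euclid_norm_ge_0[of "row A i"] by linarith
  define x where "x = complex_of_real (1 / r) \<cdot>\<^sub>v conjugate (row A i)"
  have x: "x \<in> carrier_vec (dim_col A)"
    unfolding x_def by (intro carrier_vecI) simp
  have "euclid_norm (conjugate (row A i)) = r"
    by (simp add: r_def euclid_norm_def L2_set_def)
  then have x1: "euclid_norm x = 1"
    unfolding x_def euclid_norm_smult using r by (simp add: norm_divide)
  have "row A i \<bullet> x = complex_of_real (1 / r) * (conjugate (row A i) \<bullet> row A i)"
    unfolding x_def by (simp add: conjugate_vec_sprod_comm[where n = "dim_col A"])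
  also have "\<dots> = complex_of_real r"
    using r by (simp flip: euclid_norm_sq_eq_scalar_prod r_def add: power2_eq_square)
  finally have "cmod ((A *\<^sub>v x) $ i) = r" using i r by simp
  then have "r \<le> euclid_norm (A *\<^sub>v x)"
    using cmod_vec_index_le[of i "A *\<^sub>v x"] i by simp
  also have "\<dots> \<le> op_norm A" using x x1 by (intro op_norm_upper) auto
  finally show ?thesis by (simp add: r_def)
qed simp

section \<open>Dual norm and matrix-level norm\<close>

text \<open>Rescale \<open>z\<close> into the unit ball of \<open>N\<close> and compare with the
  supremum. The coordinate bound makes that supremum one over a bounded set, and it forces
  \<open>z\<close> to vanish when \<open>N z = 0\<close>.\<close>

lemma dual_norm_pairing_le:
  assumes l: "dual_norm N l \<le> 1"
    and nonneg: "\<And>z. 0 \<le> N z"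
    and homog: "\<And>c z. N (c * fst z, c * snd z) \<le> cmod c * N z"
    and bound: "\<And>z. cmod (fst z) \<le> K * N z" "\<And>z. cmod (snd z) \<le> K * N z"
  shows "cmod (fst l * fst z + snd l * snd z) \<le> N z"
proof (cases "N z = 0")
  case True
  then show ?thesis using bound[of z] by simp
next
  case False
  then have pos: "N z > 0" using nonneg[of z] by simp
  define c where "c = complex_of_real (1 / N z)"
  define w where "w = (c * fst z, c * snd z)"
  have "N w \<le> 1"
    using homog[of c z] pos by (simp add: w_def c_def norm_divide)
  have "bdd_above ((\<lambda>z. cmod (fst l * fst z + snd l * snd z)) ` {z. N z \<le> 1})"
  proof (rule bdd_aboveI2)
    fix z assume "z \<in> {z. N z \<le> 1}"
    then have z: "\<bar>K\<bar> * N z \<le> \<bar>K\<bar>" by (simp add: mult_left_le)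
    have "K * N z \<le> \<bar>K\<bar> * N z" by (simp add: mult_right_mono nonneg)
    then have "cmod (fst z) \<le> \<bar>K\<bar>" "cmod (snd z) \<le> \<bar>K\<bar>"
      using bound[of z] z by linarith+
    then have "cmod (fst l) * cmod (fst z) + cmod (snd l) * cmod (snd z)
        \<le> cmod (fst l) * \<bar>K\<bar> + cmod (snd l) * \<bar>K\<bar>"
      by (intro add_mono mult_left_mono) auto
    then show "cmod (fst l * fst z + snd l * snd z) \<le> cmod (fst l) * \<bar>K\<bar> + cmod (snd l) * \<bar>K\<bar>"
      by (intro order.trans[OF norm_triangle_ineq]) (simp add: norm_mult)
  qed
  then have "cmod (fst l * fst w + snd l * snd w) \<le> dual_norm N l"
    unfolding dual_norm_def by (rule cSUP_upper2[where x = w]) (use \<open>N w \<le> 1\<close> in auto)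
  also have "fst l * fst w + snd l * snd w = c * (fst l * fst z + snd l * snd z)"
    by (simp add: w_def algebra_simps)
  also have "cmod \<dots> = cmod (fst l * fst z + snd l * snd z) / N z"
    using pos by (simp add: norm_mult c_def norm_divide)
  finally have "cmod (fst l * fst z + snd l * snd z) / N z \<le> 1"
    using l by linarith
  then show ?thesis using pos by (simp add: divide_le_eq)
qed

text \<open>The condition on \<open>N (0, 0)\<close> makes both suprema range over nonempty sets: it
  puts \<open>(0, 0)\<close> into the unit ball of \<open>N\<close>, and then into the dual
  ball.\<close>

lemma matrix_level_norm_leI:
  assumes "\<And>l. dual_norm N l \<le> 1 \<Longrightarrow> op_norm (fst l \<cdot>\<^sub>m T1 + snd l \<cdot>\<^sub>m T2) \<le> c"
    and N0: "N (0, 0) \<le> 1"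
  shows "matrix_level_norm N T1 T2 \<le> c"
  unfolding matrix_level_norm_def
proof (rule cSUP_least)
  have "dual_norm N (0, 0) \<le> 1"
    unfolding dual_norm_def by (rule cSUP_least) (use N0 in auto)
  then show "{l. dual_norm N l \<le> 1} \<noteq> {}" by blast
qed (use assms in auto)

section \<open>Two by two matrices and a unitary normal form for singular ones\<close>

definition mat2 :: "complex \<Rightarrow> complex \<Rightarrow> complex \<Rightarrow> complex \<Rightarrow> complex mat" where
  "mat2 a b c d = mat 2 2 (\<lambda>(i, j). if i = 0 then if j = 0 then a else b else if j = 0 then c else d)"

lemma mat2_carrier [simp]: "mat2 a b c d \<in> carrier_mat 2 2"
  by (simp add: mat2_def)

lemma mat2_dim [simp]: "dim_row (mat2 a b c d) = 2" "dim_col (mat2 a b c d) = 2"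
  by (simp_all add: mat2_def)

lemma mat2_index [simp]:
  "mat2 a b c d $$ (0, 0) = a" "mat2 a b c d $$ (0, Suc 0) = b"
  "mat2 a b c d $$ (Suc 0, 0) = c" "mat2 a b c d $$ (Suc 0, Suc 0) = d"
  by (simp_all add: mat2_def)

lemma mat2_eqI:
  assumes "A \<in> carrier_mat 2 2" "A $$ (0, 0) = a" "A $$ (0, Suc 0) = b"
    "A $$ (Suc 0, 0) = c" "A $$ (Suc 0, Suc 0) = d"
  shows "A = mat2 a b c d"
  by (rule eq_matI) (use assms in \<open>auto simp: less_2_cases_iff\<close>)

lemma mat2_mult:
  "mat2 a b c d * mat2 e f g h = mat2 (a * e + b * g) (a * f + b * h) (c * e + d * g) (c * f + d * h)"
  by (rule mat2_eqI) (auto simp: scalar_prod_def numeral_2_eq_2)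

lemma mat2_smult: "x \<cdot>\<^sub>m mat2 a b c d = mat2 (x * a) (x * b) (x * c) (x * d)"
  by (rule mat2_eqI) auto

lemma mat2_add: "mat2 a b c d + mat2 e f g h = mat2 (a + e) (b + f) (c + g) (d + h)"
  by (rule mat2_eqI) auto

lemma mat2_adjoint: "mat_adjoint (mat2 a b c d) = mat2 (cnj a) (cnj c) (cnj b) (cnj d)"
  by (rule mat2_eqI) (auto simp: mat_adjoint_carrier index_mat_adjoint[of _ 2 2])

lemma mat2_one: "1\<^sub>m 2 = mat2 1 0 0 1"
  by (rule mat2_eqI) auto

lemma mat2_zero: "0\<^sub>m 2 2 = mat2 0 0 0 0"
  by (rule mat2_eqI) auto

lemma mat2_inject: "mat2 a b c d = mat2 a' b' c' d' \<longleftrightarrow> a = a' \<and> b = b' \<and> c = c' \<and> d = d'"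
  by (metis mat2_index)

lemma diagonal_mat2: "diagonal_mat (mat2 a 0 0 d)"
  by (auto simp: diagonal_mat_def less_2_cases_iff)

lemma mat2_bilinear:
  assumes "x \<in> carrier_vec 2" "y \<in> carrier_vec 2"
  shows "y \<bullet> (mat2 a b c d *\<^sub>v x) =
    y $ 0 * (a * x $ 0 + b * x $ Suc 0) + y $ Suc 0 * (c * x $ 0 + d * x $ Suc 0)"
  using assms by (simp add: scalar_prod_def numeral_2_eq_2)

lemma unitary_mat2:
  assumes "a * cnj a + b * cnj b = 1"
  shows "unitary_mat 2 (mat2 a b (- cnj b) (cnj a))"
  using assms by (simp add: unitary_mat_def mat2_adjoint mat2_mult mat2_one mat2_inject algebra_simps)

text \<open>Normalize \<open>(y, -x)\<close>; for the zero vector any unit vector works.\<close>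

lemma exists_unit_annihilator:
  fixes x y :: complex
  shows "\<exists>a b. a * cnj a + b * cnj b = 1 \<and> a * x + b * y = 0"
proof (cases "x = 0 \<and> y = 0")
  case False
  define n where "n = sqrt ((cmod x)\<^sup>2 + (cmod y)\<^sup>2)"
  have n2: "n\<^sup>2 = (cmod x)\<^sup>2 + (cmod y)\<^sup>2" by (simp add: n_def)
  have "n\<^sup>2 \<noteq> 0" using False by (simp add: n2 add_nonneg_eq_0_iff)
  have "complex_of_real (n\<^sup>2) = x * cnj x + y * cnj y"
    unfolding n2 by (simp add: complex_norm_square del: of_real_power)
  moreover have "y / n * cnj (y / n) + (- x / n) * cnj (- x / n) = (x * cnj x + y * cnj y) / complex_of_real (n\<^sup>2)"
    by (simp add: add_divide_distrib power2_eq_square)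
  ultimately have "y / n * cnj (y / n) + (- x / n) * cnj (- x / n) = 1"
    using \<open>n\<^sup>2 \<noteq> 0\<close> by (metis divide_self of_real_eq_0_iff)
  moreover have "y / n * x + (- x / n) * y = 0" by (simp add: field_simps)
  ultimately show ?thesis by blast
qed (intro exI[of _ 1] exI[of _ 0], simp)

text \<open>A singular matrix kills some unit vector \<open>(a, b)\<close>. Taking it as second
  column of \<open>W\<close> leaves only a first column \<open>(g, h)\<close>, which
  \<open>U\<close> rotates onto the first axis.\<close>

lemma singular_mat2_unitary_normal_form:
  assumes det: "p * s = q * r"
  obtains U W k where "unitary_mat 2 U" "unitary_mat 2 W" "U * mat2 p q r s * W = mat2 k 0 0 0"
proof -
  obtain a b where ab: "a * cnj a + b * cnj b = 1" "a * p + b * q = 0" "a * r + b * s = 0"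
  proof (cases "p = 0 \<and> q = 0")
    case True
    then show ?thesis using exists_unit_annihilator[of r s] that by auto
  next
    case False
    obtain a b where ab: "a * cnj a + b * cnj b = 1" "a * p + b * q = 0"
      using exists_unit_annihilator by blast
    \<comment> \<open>Since \<open>p * s = q * r\<close>, a vector killed by the nonzero first row
      is killed by the second: multiply the second equation by \<open>p\<close> and by
      \<open>q\<close>, one of which can be cancelled.\<close>
    have "p * (a * r + b * s) = r * (a * p) + b * (p * s)"
      by (simp add: algebra_simps)
    also have "\<dots> = r * (a * p + b * q)"
      unfolding det by (simp add: algebra_simps)
    finally have 1: "p * (a * r + b * s) = 0" using ab by simp
    have "q * (a * r + b * s) = a * (q * r) + s * (b * q)"
      by (simp add: algebra_simps)
    also have "\<dots> = s * (a * p + b * q)"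
      unfolding det[symmetric] by (simp add: algebra_simps)
    finally have 2: "q * (a * r + b * s) = 0" using ab by simp
    then have "a * r + b * s = 0" using False 1 2 by auto
    then show ?thesis using ab that by blast
  qed
  define g where "g = p * cnj b - q * cnj a"
  define h where "h = r * cnj b - s * cnj a"
  obtain e f where ef: "e * cnj e + f * cnj f = 1" "e * g + f * h = 0"
    using exists_unit_annihilator by blast
  have "unitary_mat 2 (mat2 (cnj f) (- cnj e) e f)"
    using unitary_mat2[of "cnj f" "- cnj e"] ef by (simp add: algebra_simps)
  moreover have "unitary_mat 2 (mat2 (cnj b) a (- cnj a) b)"
    using unitary_mat2[of "cnj b" a] ab by (simp add: algebra_simps)
  moreover have "mat2 (cnj f) (- cnj e) e f * mat2 p q r s * mat2 (cnj b) a (- cnj a) b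
      = mat2 (cnj f * g - cnj e * h) 0 0 0"
  proof -
    have "mat2 p q r s * mat2 (cnj b) a (- cnj a) b = mat2 g 0 h 0"
      using ab by (simp add: mat2_mult mat2_inject g_def h_def algebra_simps)
    then have "mat2 (cnj f) (- cnj e) e f * (mat2 p q r s * mat2 (cnj b) a (- cnj a) b)
        = mat2 (cnj f * g - cnj e * h) 0 0 0"
      using ef by (simp add: mat2_mult mat2_inject)
    then show ?thesis
      by (subst assoc_mult_mat[where n\<^sub>1 = 2 and n\<^sub>2 = 2 and n\<^sub>3 = 2 and n\<^sub>4 = 2]) auto
  qed
  ultimately show ?thesis using that by blast
qed

text \<open>The quadratic formula in homogeneous coordinates, with zero
  \<open>(w - q, 2 * p)\<close> for a square root \<open>w\<close> of the discriminant.\<close>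

lemma binary_quadratic_form_zero:
  fixes p q r :: complex
  obtains x y where "x \<noteq> 0 \<or> y \<noteq> 0" "p * x\<^sup>2 + q * x * y + r * y\<^sup>2 = 0"
proof (cases "p = 0")
  case True
  then show ?thesis using that[of 1 0] by simp
next
  case False
  define w where "w = csqrt (q\<^sup>2 - 4 * p * r)"
  have "w\<^sup>2 = q\<^sup>2 - 4 * p * r" by (simp add: w_def)
  moreover have "p * (w - q)\<^sup>2 + q * (w - q) * (2 * p) + r * (2 * p)\<^sup>2
      = p * (w\<^sup>2 - (q\<^sup>2 - 4 * p * r))"
    by (simp add: power2_eq_square algebra_simps)
  ultimately have "p * (w - q)\<^sup>2 + q * (w - q) * (2 * p) + r * (2 * p)\<^sup>2 = 0" by simp
  then show ?thesis using that[of "w - q" "2 * p"] False by simp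
qed

section \<open>Estimates on product vectors and the pair in normal form\<close>

text \<open>The form belongs to a matrix with zero corner, so each term contains \<open>x1\<close>
  or \<open>y1\<close> and is at most a coefficient times \<open>t\<close>, the larger of their
  moduli. Finally \<open>t\<close> squared is at most 2 minus the squares of \<open>cmod x0\<close>
  and \<open>cmod y0\<close>, hence at most \<open>2 * (1 - cmod y0 * cmod x0)\<close>.\<close>

lemma cmod_bilinear_sq_le:
  assumes x: "(cmod x0)\<^sup>2 + (cmod x1)\<^sup>2 \<le> 1" and y: "(cmod y0)\<^sup>2 + (cmod y1)\<^sup>2 \<le> 1"
  shows "(cmod (y0 * (b * x1) + y1 * (c * x0 + d * x1)))\<^sup>2
    \<le> 2 * (cmod b + cmod c + cmod d)\<^sup>2 * (1 - cmod y0 * cmod x0)"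
proof -
  define t where "t = max (cmod x1) (cmod y1)"
  have le_one: "u \<le> 1" if "u\<^sup>2 + v\<^sup>2 \<le> 1" for u v :: real
  proof -
    have "u\<^sup>2 \<le> 1\<^sup>2" using that zero_le_power2[of v] unfolding one_power2 by linarith
    then show ?thesis by (rule power2_le_imp_le) simp
  qed
  have le1: "cmod x0 \<le> 1" "cmod y0 \<le> 1" "cmod x1 \<le> 1"
    using le_one[OF x] le_one[OF y] le_one[of "cmod x1" "cmod x0"] x by (simp_all add: add.commute)
  have t: "cmod x1 \<le> t" "cmod y1 \<le> t" "0 \<le> t" by (auto simp: t_def le_max_iff_disj)
  have b: "cmod (y0 * (b * x1)) \<le> cmod b * t"
    unfolding norm_mult using mult_mono[OF le1(2) mult_left_mono[OF t(1), of "cmod b"]] by simp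
  have c: "cmod (y1 * (c * x0)) \<le> cmod c * t"
    unfolding norm_mult using mult_mono[OF t(2) mult_left_mono[OF le1(1), of "cmod c"]] t
    by (simp add: mult.commute)
  have d: "cmod (y1 * (d * x1)) \<le> cmod d * t"
    unfolding norm_mult using mult_mono[OF t(2) mult_left_mono[OF le1(3), of "cmod d"]] t
    by (simp add: mult.commute)
  have "cmod (y0 * (b * x1) + y1 * (c * x0 + d * x1))
      \<le> cmod (y0 * (b * x1)) + (cmod (y1 * (c * x0)) + cmod (y1 * (d * x1)))"
    unfolding distrib_left by (intro order.trans[OF norm_triangle_ineq] add_left_mono norm_triangle_ineq)
  also have "\<dots> \<le> (cmod b + cmod c + cmod d) * t"
    using b c d by (simp add: algebra_simps)
  finally have "(cmod (y0 * (b * x1) + y1 * (c * x0 + d * x1)))\<^sup>2 \<le> ((cmod b + cmod c + cmod d) * t)\<^sup>2"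
    by (rule power_mono) simp
  also have "\<dots> = (cmod b + cmod c + cmod d)\<^sup>2 * t\<^sup>2" by (simp add: power_mult_distrib)
  also have "\<dots> \<le> (cmod b + cmod c + cmod d)\<^sup>2 * (2 * (1 - cmod y0 * cmod x0))"
  proof (rule mult_left_mono)
    have "t\<^sup>2 \<le> (cmod x1)\<^sup>2 + (cmod y1)\<^sup>2" by (simp add: t_def max_def)
    moreover have "2 * (cmod y0 * cmod x0) \<le> (cmod y0)\<^sup>2 + (cmod x0)\<^sup>2"
      using sum_squares_bound[of "cmod y0" "cmod x0"] by simp
    ultimately have "t\<^sup>2 \<le> 2 - 2 * (cmod y0 * cmod x0)" using x y by linarith
    then show "t\<^sup>2 \<le> 2 * (1 - cmod y0 * cmod x0)" by (simp only: right_diff_distrib mult_1_right)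
  qed simp
  finally show ?thesis by (simp only: mult_ac)
qed

text \<open>Both \<open>1 - s\<close> and \<open>1 - t\<close> are at most \<open>1 - s * t\<close>,
  so the squared product of \<open>p\<close> and \<open>q\<close> is at most the square of
  \<open>K * (1 - s * t)\<close>. This is the trade-off between corner and remainder.\<close>

lemma scaled_product_plus_product_le:
  fixes s t K :: real
  assumes s: "0 \<le> s" "s \<le> 1" and t: "0 \<le> t" "t \<le> 1"
    and p: "p\<^sup>2 \<le> K * (1 - s)" "0 \<le> p" and q: "q\<^sup>2 \<le> K * (1 - t)" "0 \<le> q" and K: "0 \<le> K"
  shows "K * (s * t) + p * q \<le> K"
proof -
  have "(p * q)\<^sup>2 \<le> (K * (1 - s)) * (K * (1 - t))"
    unfolding power_mult_distrib using p q s K by (intro mult_mono) auto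
  also have "\<dots> \<le> (K * (1 - s * t)) * (K * (1 - s * t))"
    using s t K mult_left_le[of t s] mult_left_le_one_le[of t s]
    by (intro mult_mono mult_left_mono) (auto simp: mult_le_one)
  finally have "(p * q)\<^sup>2 \<le> (K * (1 - s * t))\<^sup>2" by (simp only: power2_eq_square)
  moreover have "0 \<le> K * (1 - s * t)" using K s t by (simp add: mult_le_one)
  ultimately have "p * q \<le> K * (1 - s * t)" by (rule power2_le_imp_le)
  then show ?thesis by (simp add: algebra_simps)
qed

lemma euclid_norm_carrier_2:
  assumes "x \<in> carrier_vec 2" "euclid_norm x \<le> 1"
  shows "(cmod (x $ 0))\<^sup>2 + (cmod (x $ Suc 0))\<^sup>2 \<le> 1"
proof -
  have "dim_vec x = Suc (Suc 0)" using assms(1) by auto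
  then have "(euclid_norm x)\<^sup>2 = (cmod (x $ 0))\<^sup>2 + (cmod (x $ Suc 0))\<^sup>2"
    unfolding euclid_norm_sq by simp
  moreover have "(euclid_norm x)\<^sup>2 \<le> 1" using assms by (simp add: power_le_one)
  ultimately show ?thesis by simp
qed

text \<open>A second nonzero entry pushes the Euclidean norm of \<open>v\<close> strictly above
  \<open>k\<close>. The vector will be a row or a column of \<open>A\<close>.\<close>

lemma op_norm_gt_of_two_entries:
  assumes v: "euclid_norm v \<le> op_norm A" and i: "i < dim_vec v" "j < dim_vec v" "i \<noteq> j"
    and "v $ i = complex_of_real k" "v $ j \<noteq> 0"
  shows "op_norm A > k"
proof (rule ccontr)
  assume "\<not> op_norm A > k"
  then have "euclid_norm v \<le> k" using v by simp
  then have "(euclid_norm v)\<^sup>2 \<le> k\<^sup>2" by (rule power_mono) simp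
  moreover have "(\<Sum>l\<in>{i, j}. (cmod (v $ l))\<^sup>2) \<le> (euclid_norm v)\<^sup>2"
    unfolding euclid_norm_sq by (rule sum_mono2) (use i in auto)
  moreover have "(\<Sum>l\<in>{i, j}. (cmod (v $ l))\<^sup>2) = k\<^sup>2 + (cmod (v $ j))\<^sup>2"
    using assms by simp
  moreover have "(cmod (v $ j))\<^sup>2 > 0" using assms by simp
  ultimately show False by linarith
qed

text \<open>
  Here \<open>m1 B1 + m2 B2 = E\<^bsub>11\<^esub>\<close>, \<open>a2 B1 - a1 B2 = D = (0, b; c, d)\<close>, and \<open>T1\<close>, \<open>T2\<close> are chosen
  so that \<open>T1 \<otimes> B1 + T2 \<otimes> B2 = K E\<^bsub>11\<^esub> \<otimes> E\<^bsub>11\<^esub> + D \<otimes> D\<close>.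
\<close>

lemma normal_form_not_completely_contractive:
  fixes a1 a2 m1 m2 b c d :: complex
  assumes one: "m1 * a1 + m2 * a2 = 1" and bc: "b \<noteq> 0 \<or> c \<noteq> 0"
  defines "B1 \<equiv> mat2 a1 (m2 * b) (m2 * c) (m2 * d)"
    and "B2 \<equiv> mat2 a2 (- m1 * b) (- m1 * c) (- m1 * d)"
  shows "\<not> completely_contractive (Omega_norm B1 B2) (\<lambda>z. fst z \<cdot>\<^sub>m B1 + snd z \<cdot>\<^sub>m B2)"
proof
  assume cc: "completely_contractive (Omega_norm B1 B2) (\<lambda>z. fst z \<cdot>\<^sub>m B1 + snd z \<cdot>\<^sub>m B2)"
  define N where "N = Omega_norm B1 B2"
  define m where "m = cmod b + cmod c + cmod d"
  \<comment> \<open>The constant of \<open>cmod_bilinear_sq_le\<close>, so that its conclusion is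
    the hypothesis on \<open>p\<close> and \<open>q\<close> in
    \<open>scaled_product_plus_product_le\<close>.\<close>
  define K where "K = 2 * m\<^sup>2"
  \<comment> \<open>With \<open>E\<close> the corner matrix unit, these solve
    \<open>a1 T1 + a2 T2 = K E\<close> and \<open>m2 T1 - m1 T2 = D\<close>.\<close>
  define T1 where "T1 = mat2 (K * m1) (a2 * b) (a2 * c) (a2 * d)"
  define T2 where "T2 = mat2 (K * m2) (- a1 * b) (- a1 * c) (- a1 * d)"
  have K: "0 \<le> K" by (simp add: K_def)
  \<comment> \<open>Here \<open>s\<close> and \<open>t\<close> are the coordinates of
    \<open>z1 B1 + z2 B2\<close> with respect to \<open>E\<close> and \<open>D\<close>.\<close>
  have N: "N z = op_norm (mat2 s (t * b) (t * c) (t * d))"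
    if "s = a1 * fst z + a2 * snd z" "t = m2 * fst z - m1 * snd z" for z s t
    unfolding N_def Omega_norm_def B1_def B2_def mat2_smult mat2_add that
    by (simp add: algebra_simps)
  have nonneg: "0 \<le> N z" for z by (simp add: N_def Omega_norm_def)
  have homog: "N (e * fst z, e * snd z) \<le> cmod e * N z" for e z
  proof -
    have "(e * fst z) \<cdot>\<^sub>m B1 + (e * snd z) \<cdot>\<^sub>m B2 = e \<cdot>\<^sub>m (fst z \<cdot>\<^sub>m B1 + snd z \<cdot>\<^sub>m B2)"
      by (simp add: B1_def B2_def mat2_smult mat2_add algebra_simps)
    then show ?thesis using op_norm_smult_le by (simp add: N_def Omega_norm_def)
  qed
  \<comment> \<open>Entries of the matrix bound \<open>s\<close> and \<open>t\<close>, the latter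
    because \<open>D\<close> has a nonzero off-diagonal entry. By \<open>one\<close> the passage
    from \<open>z\<close> to \<open>(s, t)\<close> has determinant -1, so it can be inverted to
    bound \<open>z\<close>.\<close>
  obtain C where C: "cmod (fst z) \<le> C * N z" "cmod (snd z) \<le> C * N z" for z
  proof -
    define g where "g = max (cmod b) (cmod c)"
    have g: "g > 0" using bc by (auto simp: g_def less_max_iff_disj)
    define C where "C = cmod m1 + cmod m2 + (cmod a1 + cmod a2) / g"
    have "cmod (fst z) \<le> C * N z \<and> cmod (snd z) \<le> C * N z" for z
    proof -
      define s where "s = a1 * fst z + a2 * snd z"
      define t where "t = m2 * fst z - m1 * snd z"
      define X where "X = mat2 s (t * b) (t * c) (t * d)"
      have NX: "N z = op_norm X" unfolding X_def by (rule N) (simp_all add: s_def t_def)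
      have entry: "cmod (X $$ (i, j)) \<le> N z" if "i < 2" "j < 2" for i j
        using cmod_vec_index_le[of i "col X j"] euclid_norm_col_le_op_norm[of j X] that
        by (simp add: NX X_def)
      have s: "cmod s \<le> N z" using entry[of 0 0] by (simp add: X_def)
      have "cmod t * g \<le> N z"
        using entry[of 0 "Suc 0"] entry[of "Suc 0" 0] by (simp add: X_def norm_mult g_def max_def)
      then have t: "cmod t \<le> N z / g" using g by (simp add: field_simps)
      have "fst z = (m1 * a1 + m2 * a2) * fst z" "snd z = (m1 * a1 + m2 * a2) * snd z"
        by (simp_all add: one)
      then have z: "fst z = m1 * s + a2 * t" "snd z = m2 * s + - a1 * t"
        by (simp_all add: s_def t_def algebra_simps)
      have step: "cmod (u * s + v * t) \<le> C * N z"
        if "cmod u \<le> cmod m1 + cmod m2" "cmod v \<le> cmod a1 + cmod a2" for u v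
      proof -
        have "cmod (u * s + v * t) \<le> cmod u * cmod s + cmod v * cmod t"
          by (rule order.trans[OF norm_triangle_ineq]) (simp add: norm_mult)
        also have "\<dots> \<le> (cmod m1 + cmod m2) * N z + (cmod a1 + cmod a2) * (N z / g)"
          using that s t by (intro add_mono mult_mono) auto
        also have "\<dots> = C * N z" by (simp add: C_def algebra_simps add_divide_distrib)
        finally show ?thesis .
      qed
      show ?thesis
        using step[of m1 a2] step[of m2 "- a1"] unfolding z[symmetric] by simp
    qed
    then show ?thesis using that by blast
  qed
  \<comment> \<open>This bounds the form of \<open>K E \<otimes> E + D \<otimes> D\<close> on
    product vectors: \<open>f\<close> is the value of \<open>D\<close> at \<open>(v, u)\<close>, the
    \<open>h\<close> below is its value at \<open>(y, x)\<close>, and the total is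
    \<open>K * (v0 * u0) * (y0 * x0) + f * h\<close>.\<close>
  have bil: "cmod (y \<bullet> (mat2 (K * (v0 * u0)) (f * b) (f * c) (f * d) *\<^sub>v x)) \<le> K"
    if x: "x \<in> carrier_vec 2" "euclid_norm x \<le> 1" and y: "y \<in> carrier_vec 2" "euclid_norm y \<le> 1"
      and u: "(cmod u0)\<^sup>2 + (cmod u1)\<^sup>2 \<le> 1" and v: "(cmod v0)\<^sup>2 + (cmod v1)\<^sup>2 \<le> 1"
      and f: "f = v0 * (b * u1) + v1 * (c * u0 + d * u1)" for x y and u0 u1 v0 v1 f :: complex
  proof -
    note x' = euclid_norm_carrier_2[OF x] and y' = euclid_norm_carrier_2[OF y]
    define h where "h = y $ 0 * (b * x $ Suc 0) + y $ Suc 0 * (c * x $ 0 + d * x $ Suc 0)"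
    have prod_le1: "cmod v0 * cmod u0 \<le> 1"
      if "(cmod u0)\<^sup>2 + (cmod u1)\<^sup>2 \<le> 1" "(cmod v0)\<^sup>2 + (cmod v1)\<^sup>2 \<le> 1" for u0 u1 v0 v1 :: complex
    proof -
      have "2 * (cmod v0 * cmod u0) \<le> (cmod v0)\<^sup>2 + (cmod u0)\<^sup>2"
        using sum_squares_bound[of "cmod v0" "cmod u0"] by simp
      then show ?thesis using that zero_le_power2[of "cmod u1"] zero_le_power2[of "cmod v1"] by linarith
    qed
    have "y \<bullet> (mat2 (K * (v0 * u0)) (f * b) (f * c) (f * d) *\<^sub>v x)
        = K * ((v0 * u0) * (y $ 0 * x $ 0)) + f * h"
      using x y by (simp add: mat2_bilinear h_def algebra_simps)
    also have "cmod \<dots> \<le> K * ((cmod v0 * cmod u0) * (cmod (y $ 0) * cmod (x $ 0))) + cmod f * cmod h"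
      using K by (intro order.trans[OF norm_triangle_ineq]) (simp add: norm_mult)
    also have "\<dots> \<le> K"
      using K prod_le1[OF u v] prod_le1[OF x' y'] cmod_bilinear_sq_le[OF u v, of b c d]
        cmod_bilinear_sq_le[OF x' y', of b c d]
      by (intro scaled_product_plus_product_le) (auto simp: K_def m_def f h_def)
    finally show ?thesis .
  qed
  have "matrix_level_norm N T1 T2 \<le> K"
  proof (rule matrix_level_norm_leI)
    fix l assume l: "dual_norm N l \<le> 1"
    have "fst l \<cdot>\<^sub>m T1 + snd l \<cdot>\<^sub>m T2 \<in> carrier_mat 2 2" by (simp add: T1_def T2_def)
    then show "op_norm (fst l \<cdot>\<^sub>m T1 + snd l \<cdot>\<^sub>m T2) \<le> K"
    proof (rule op_norm_leI)
      fix x y :: "complex vec"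
      assume x: "x \<in> carrier_vec 2" "euclid_norm x \<le> 1" and y: "y \<in> carrier_vec 2" "euclid_norm y \<le> 1"
      \<comment> \<open>For fixed \<open>x\<close> and \<open>y\<close> the two components give a
        point \<open>z\<close> of the plane, on which \<open>l\<close> acts as a functional of dual
        norm at most 1. In the coordinates \<open>(s, t)\<close> this point is
        \<open>(K * y0 * x0, f)\<close>.\<close>
      define z where "z = (y \<bullet> (T1 *\<^sub>v x), y \<bullet> (T2 *\<^sub>v x))"
      define f where "f = y $ 0 * (b * x $ Suc 0) + y $ Suc 0 * (c * x $ 0 + d * x $ Suc 0)"
      have z: "fst z = K * m1 * (y $ 0 * x $ 0) + a2 * f" "snd z = K * m2 * (y $ 0 * x $ 0) - a1 * f"
        unfolding z_def T1_def T2_def f_def using x y by (simp_all add: mat2_bilinear algebra_simps)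
      have "y \<bullet> ((fst l \<cdot>\<^sub>m T1 + snd l \<cdot>\<^sub>m T2) *\<^sub>v x) = fst l * fst z + snd l * snd z"
        unfolding z T1_def T2_def f_def mat2_smult mat2_add mat2_bilinear[OF x(1) y(1)]
        by (simp add: algebra_simps)
      also have "cmod \<dots> \<le> N z"
        using l nonneg homog C by (rule dual_norm_pairing_le)
      also have "N z = op_norm (mat2 (K * (y $ 0 * x $ 0)) (f * b) (f * c) (f * d))"
      proof (rule N)
        have "a1 * fst z + a2 * snd z = (m1 * a1 + m2 * a2) * (K * (y $ 0 * x $ 0))"
          unfolding z by (simp add: algebra_simps)
        then show "K * (y $ 0 * x $ 0) = a1 * fst z + a2 * snd z" by (simp add: one)
        have "m2 * fst z - m1 * snd z = (m1 * a1 + m2 * a2) * f"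
          unfolding z by (simp add: algebra_simps)
        then show "f = m2 * fst z - m1 * snd z" by (simp add: one)
      qed
      also have "\<dots> \<le> K"
      proof (rule op_norm_leI[OF mat2_carrier K])
        fix v w :: "complex vec"
        assume "v \<in> carrier_vec 2" "w \<in> carrier_vec 2" "euclid_norm v \<le> 1" "euclid_norm w \<le> 1"
        then show "cmod (w \<bullet> (mat2 (K * (y $ 0 * x $ 0)) (f * b) (f * c) (f * d) *\<^sub>v v)) \<le> K"
          using bil[OF _ _ _ _ euclid_norm_carrier_2[OF x] euclid_norm_carrier_2[OF y] f_def] by blast
      qed
      finally show "cmod (y \<bullet> ((fst l \<cdot>\<^sub>m T1 + snd l \<cdot>\<^sub>m T2) *\<^sub>v x)) \<le> K" .
    qed (rule K)
  next
    show "N (0, 0) \<le> 1"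
      using homog[of 0 "(0, 0)"] by simp
  qed
  moreover have "op_norm (kronecker T1 B1 + kronecker T2 B2) > K"
  proof -
    define M where "M = kronecker T1 B1 + kronecker T2 B2"
    have M: "M \<in> carrier_mat 4 4"
      by (simp add: M_def kronecker_def T1_def T2_def B1_def B2_def)
    have "M $$ (0, 0) = K * (m1 * a1 + m2 * a2)"
      by (simp add: M_def kronecker_def T1_def T2_def B1_def B2_def algebra_simps)
    then have M00: "M $$ (0, 0) = complex_of_real K" by (simp add: one)
    \<comment> \<open>Index 3 encodes the pair \<open>(1, 1)\<close>, where
      \<open>E \<otimes> E\<close> contributes nothing to row 0 or column 0 and
      \<open>D \<otimes> D\<close> contributes the square of \<open>b\<close> or
      \<open>c\<close>.\<close>
    have "M $$ (0, 3) = (m1 * a1 + m2 * a2) * b\<^sup>2"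
      by (simp add: M_def kronecker_def T1_def T2_def B1_def B2_def power2_eq_square algebra_simps)
    then have M03: "M $$ (0, 3) = b\<^sup>2" by (simp add: one)
    have "M $$ (3, 0) = (m1 * a1 + m2 * a2) * c\<^sup>2"
      by (simp add: M_def kronecker_def T1_def T2_def B1_def B2_def power2_eq_square algebra_simps)
    then have M30: "M $$ (3, 0) = c\<^sup>2" by (simp add: one)
    from bc have "op_norm M > K"
    proof
      assume "b \<noteq> 0"
      then show ?thesis
        using op_norm_gt_of_two_entries[of "row M 0" M 0 3 K] euclid_norm_row_le_op_norm[of 0 M] M M00 M03
        by auto
    next
      assume "c \<noteq> 0"
      then show ?thesis
        using op_norm_gt_of_two_entries[of "col M 0" M 0 3 K] euclid_norm_col_le_op_norm[of 0 M] M M00 M30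
        by auto
    qed
    then show ?thesis by (simp add: M_def)
  qed
  moreover have "op_norm (kronecker T1 B1 + kronecker T2 B2) \<le> matrix_level_norm N T1 T2"
  proof -
    have "1 \<cdot>\<^sub>m B1 + 0 \<cdot>\<^sub>m B2 = B1" "0 \<cdot>\<^sub>m B1 + 1 \<cdot>\<^sub>m B2 = B2"
      by (simp_all add: B1_def B2_def mat2_smult mat2_add)
    moreover have "T1 \<in> carrier_mat 2 2" "T2 \<in> carrier_mat 2 2"
      by (simp_all add: T1_def T2_def)
    moreover have "(1 :: nat) \<le> 2" by simp
    ultimately show ?thesis
      using cc unfolding completely_contractive_def N_def fst_conv snd_conv by metis
  qed
  ultimately show False by simp
qed

section \<open>Reduction of an arbitrary pair to the normal form\<close>

theorem theorem6p4:
  fixes A1 A2 :: "complex mat"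
  assumes "A1 \<in> carrier_mat 2 2" and "A2 \<in> carrier_mat 2 2"
    and "lin_indep_pair A1 A2"
    and "\<not> simultaneously_diagonalizable A1 A2"
  shows "\<exists>n\<ge>1. \<exists>L. linear_to_mat n L \<and>
           contractive (Omega_norm A1 A2) L \<and> \<not> completely_contractive (Omega_norm A1 A2) L"
proof -
  obtain p1 q1 r1 s1 where A1: "A1 = mat2 p1 q1 r1 s1" using mat2_eqI[OF assms(1)] by blast
  obtain p2 q2 r2 s2 where A2: "A2 = mat2 p2 q2 r2 s2" using mat2_eqI[OF assms(2)] by blast
  \<comment> \<open>The quadratic form is the determinant of \<open>x1 A1 + x2 A2\<close>.\<close>
  obtain x1 x2 where x: "x1 \<noteq> 0 \<or> x2 \<noteq> 0"
    and det: "(p1 * s1 - q1 * r1) * x1\<^sup>2 + (p1 * s2 + p2 * s1 - q1 * r2 - q2 * r1) * x1 * x2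
      + (p2 * s2 - q2 * r2) * x2\<^sup>2 = 0"
    by (rule binary_quadratic_form_zero)
  have "(x1 * p1 + x2 * p2) * (x1 * s1 + x2 * s2) - (x1 * q1 + x2 * q2) * (x1 * r1 + x2 * r2) = 0"
    unfolding det[symmetric] by (simp add: power2_eq_square algebra_simps)
  then have "(x1 * p1 + x2 * p2) * (x1 * s1 + x2 * s2) = (x1 * q1 + x2 * q2) * (x1 * r1 + x2 * r2)"
    by simp
  then obtain U W k where U: "unitary_mat 2 U" and W: "unitary_mat 2 W"
    and "U * mat2 (x1 * p1 + x2 * p2) (x1 * q1 + x2 * q2) (x1 * r1 + x2 * r2) (x1 * s1 + x2 * s2) * W
      = mat2 k 0 0 0"
    by (rule singular_mat2_unitary_normal_form)
  then have Uk: "U * (x1 \<cdot>\<^sub>m A1 + x2 \<cdot>\<^sub>m A2) * W = mat2 k 0 0 0"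
    by (simp add: A1 A2 mat2_smult mat2_add)
  have carr: "U \<in> carrier_mat 2 2" "W \<in> carrier_mat 2 2" "A1 \<in> carrier_mat 2 2" "A2 \<in> carrier_mat 2 2"
    using U W assms by (auto simp: unitary_mat_def)
  define B1 where "B1 = U * A1 * W"
  define B2 where "B2 = U * A2 * W"
  have B: "B1 \<in> carrier_mat 2 2" "B2 \<in> carrier_mat 2 2"
    using carr by (auto simp: B1_def B2_def)
  have lin: "U * (y1 \<cdot>\<^sub>m A1 + y2 \<cdot>\<^sub>m A2) * W = y1 \<cdot>\<^sub>m B1 + y2 \<cdot>\<^sub>m B2" for y1 y2
  proof -
    have "U * (y1 \<cdot>\<^sub>m A1 + y2 \<cdot>\<^sub>m A2) = y1 \<cdot>\<^sub>m (U * A1) + y2 \<cdot>\<^sub>m (U * A2)"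
      using carr mult_add_distrib_mat[of U 2 2 "y1 \<cdot>\<^sub>m A1" 2 "y2 \<cdot>\<^sub>m A2"]
        mult_smult_distrib[of U 2 2 A1 2] mult_smult_distrib[of U 2 2 A2 2] by simp
    also have "\<dots> * W = y1 \<cdot>\<^sub>m B1 + y2 \<cdot>\<^sub>m B2"
      unfolding B1_def B2_def using carr
        add_mult_distrib_mat[of "y1 \<cdot>\<^sub>m (U * A1)" 2 2 "y2 \<cdot>\<^sub>m (U * A2)" W 2]
        mult_smult_assoc_mat[of "U * A1" 2 2 W 2] mult_smult_assoc_mat[of "U * A2" 2 2 W 2]
      by (simp del: assoc_mult_mat)
    finally show ?thesis .
  qed
  have norm_eq: "op_norm (y1 \<cdot>\<^sub>m B1 + y2 \<cdot>\<^sub>m B2) = op_norm (y1 \<cdot>\<^sub>m A1 + y2 \<cdot>\<^sub>m A2)" for y1 y2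
    unfolding lin[symmetric] using U W carr by (intro op_norm_unitary) auto
  then have Omega: "Omega_norm A1 A2 = Omega_norm B1 B2"
    by (simp add: Omega_norm_def fun_eq_iff)
  obtain a1 b1 c1 d1 where B1': "B1 = mat2 a1 b1 c1 d1" using mat2_eqI[OF B(1)] by blast
  obtain a2 b2 c2 d2 where B2': "B2 = mat2 a2 b2 c2 d2" using mat2_eqI[OF B(2)] by blast
  have rel: "x1 * a1 + x2 * a2 = k" "x1 * b1 + x2 * b2 = 0" "x1 * c1 + x2 * c2 = 0" "x1 * d1 + x2 * d2 = 0"
    using Uk unfolding lin B1' B2' mat2_smult mat2_add mat2_inject by auto
  \<comment> \<open>Otherwise unitary invariance makes the norm of \<open>x1 A1 + x2 A2\<close>
    zero, and its vanishing columns contradict linear independence.\<close>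
  have "k \<noteq> 0"
  proof
    assume "k = 0"
    have "euclid_norm (col (x1 \<cdot>\<^sub>m A1 + x2 \<cdot>\<^sub>m A2) j) \<le> 0" if "j < 2" for j
    proof -
      have "op_norm (x1 \<cdot>\<^sub>m A1 + x2 \<cdot>\<^sub>m A2) = op_norm (0\<^sub>m 2 2)"
        unfolding norm_eq[symmetric] B1' B2' mat2_smult mat2_add rel \<open>k = 0\<close> mat2_zero ..
      also have "\<dots> \<le> 0" using op_norm_smult_le[of 0 "0\<^sub>m 2 2"] by simp
      finally show ?thesis
        using euclid_norm_col_le_op_norm[of j "x1 \<cdot>\<^sub>m A1 + x2 \<cdot>\<^sub>m A2"] that carr by simp
    qed
    note col = this
    have "x1 \<cdot>\<^sub>m A1 + x2 \<cdot>\<^sub>m A2 = 0\<^sub>m 2 2"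
    proof (rule eq_matI)
      fix i j assume "i < dim_row (0\<^sub>m 2 2 :: complex mat)" "j < dim_col (0\<^sub>m 2 2 :: complex mat)"
      then show "(x1 \<cdot>\<^sub>m A1 + x2 \<cdot>\<^sub>m A2) $$ (i, j) = 0\<^sub>m 2 2 $$ (i, j)"
        using order.trans[OF cmod_vec_index_le[of i "col (x1 \<cdot>\<^sub>m A1 + x2 \<cdot>\<^sub>m A2) j"] col[of j]] carr
        by simp
    qed (use carr in auto)
    then show False using x assms(3) carr unfolding lin_indep_pair_def by auto
  qed
  \<comment> \<open>Dividing by \<open>k\<close> gives \<open>m1 B1 + m2 B2 = E\<close>. The numbers
    \<open>b\<close>, \<open>c\<close>, \<open>d\<close> are entries of
    \<open>D = a2 B1 - a1 B2\<close>, whose corner cancels.\<close>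
  define m1 where "m1 = x1 / k"
  define m2 where "m2 = x2 / k"
  define b where "b = a2 * b1 - a1 * b2"
  define c where "c = a2 * c1 - a1 * c2"
  define d where "d = a2 * d1 - a1 * d2"
  have one: "m1 * a1 + m2 * a2 = 1"
    using rel(1) \<open>k \<noteq> 0\<close> by (simp add: m1_def m2_def flip: add_divide_distrib)
  \<comment> \<open>Entries outside the corner form pairs annihilated by \<open>(m1, m2)\<close>,
    hence multiples of \<open>(m2, -m1)\<close>; pairing with \<open>(a2, -a1)\<close> and using
    \<open>one\<close> identifies the factor.\<close>
  have coord: "e1 = m2 * (a2 * e1 - a1 * e2) \<and> e2 = - m1 * (a2 * e1 - a1 * e2)"
    if "x1 * e1 + x2 * e2 = 0" for e1 e2
  proof -
    have 0: "m1 * e1 + m2 * e2 = 0"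
      using that \<open>k \<noteq> 0\<close> by (simp add: m1_def m2_def flip: add_divide_distrib)
    have "(m1 * a1 + m2 * a2) * e1 = m2 * (a2 * e1 - a1 * e2) + a1 * (m1 * e1 + m2 * e2)"
      "(m1 * a1 + m2 * a2) * e2 = - m1 * (a2 * e1 - a1 * e2) + a2 * (m1 * e1 + m2 * e2)"
      by (simp_all add: algebra_simps)
    then show ?thesis unfolding one 0 by simp
  qed
  have B1m: "B1 = mat2 a1 (m2 * b) (m2 * c) (m2 * d)"
    and B2m: "B2 = mat2 a2 (- m1 * b) (- m1 * c) (- m1 * d)"
    unfolding B1' B2' b_def c_def d_def mat2_inject
    using coord[OF rel(2)] coord[OF rel(3)] coord[OF rel(4)] by blast+
  \<comment> \<open>If both vanished, \<open>U\<close> and \<open>W\<close> would diagonalize the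
    two matrices simultaneously.\<close>
  have "b \<noteq> 0 \<or> c \<noteq> 0"
  proof (rule ccontr)
    assume "\<not> (b \<noteq> 0 \<or> c \<noteq> 0)"
    then have "diagonal_mat B1" "diagonal_mat B2"
      unfolding B1m B2m by (simp_all add: diagonal_mat2)
    then show False
      using assms(4) U W unfolding simultaneously_diagonalizable_def B1_def B2_def by blast
  qed
  \<comment> \<open>Passing from \<open>A1\<close>, \<open>A2\<close> to \<open>B1\<close>,
    \<open>B2\<close> preserves the norm, so \<open>L\<close> is isometric.\<close>
  define L where "L = (\<lambda>z. fst z \<cdot>\<^sub>m B1 + snd z \<cdot>\<^sub>m B2)"
  have "\<not> completely_contractive (Omega_norm A1 A2) L"
    unfolding Omega L_def B1m B2m
    by (rule normal_form_not_completely_contractive[OF one \<open>b \<noteq> 0 \<or> c \<noteq> 0\<close>])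
  moreover have "contractive (Omega_norm A1 A2) L"
    unfolding Omega by (simp add: contractive_def L_def Omega_norm_def)
  moreover have "linear_to_mat 2 L"
    unfolding linear_to_mat_def L_def B1' B2' by (simp add: mat2_smult mat2_add algebra_simps)
  ultimately show ?thesis by (intro exI[of _ 2] conjI exI[of _ L]) simp_all
qed

end
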